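(* For any positive integers $\alpha,\beta,m,n,r$, we have $$\frac{2}{\operatorname{lcm}(n,n+1,\ldots,n+2\beta+1)}\sum_{k=1}^{n}(k)_{\beta}^r\,(k+\beta+1)_{\beta}^r\,(k+\beta)\prod_{i=0}^{2\beta-1}w_{k+i}^{(\alpha)}(x)^m\in\mathbb{Z}[x].$$
   Context: $\operatorname{lcm}$ denotes the least common multiple. $(y)_0=1$ and $(y)_N=y(y+1)\cdots(y+N-1)$ for $N\ge1$ is the rising factorial, and $(y)_N^r$ is its $r$-th power. For positive integers $k,\alpha$, $$w_k^{(\alpha)}(x)=\sum_{j=1}^{k}w(k,j)^{\alpha}x^{j-1},\qquad w(k,j)=\frac1j\binom{k-1}{j-1}\binom{k+j}{j-1}=\binom{k-1}{j-1}\binom{k+j}{j}-\binom{k}{j}\binom{k+j}{j-1}\in\mathbb{Z}.$$ *)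

theory Defs
  imports Complex_Main "HOL-Computational_Algebra.Polynomial"
begin

(* used only for 1 \<le> j \<le> k, where both index subtractions are exact *)
definition w_num :: "nat \<Rightarrow> nat \<Rightarrow> rat" where
  "w_num k j = 1 / of_nat j * of_nat ((k - 1) choose (j - 1)) * of_nat ((k + j) choose (j - 1))"

lemma w_num_eq_diff:
  assumes "1 \<le> j" "j \<le> k"
  shows "w_num k j = of_nat ((k - 1) choose (j - 1)) * of_nat ((k + j) choose j)
                 - of_nat (k choose j) * of_nat ((k + j) choose (j - 1))"
proof -
  obtain i where j: "j = Suc i" using assms(1) by (cases j) auto
  obtain l where k: "k = Suc l" using assms by (cases k) auto
  have "Suc i * (Suc l choose Suc i) = Suc l * (l choose i)"
    by (simp only: Suc_times_binomial_eq mult.commute)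
  hence a: "of_nat (Suc l choose Suc i) = (of_nat (Suc l) * of_nat (l choose i) / of_nat (Suc i) :: rat)"
    by (simp add: field_simps flip: of_nat_mult del: of_nat_Suc binomial_Suc_Suc)
  have "Suc i * ((k + j) choose Suc i) = (Suc l + 1) * ((k + j) choose i)"
    using binomial_absorb_comp[of "k + j" i] binomial_absorption[of i "k + j"]
    by (simp add: j k del: binomial_Suc_Suc)
  hence b: "of_nat ((k + j) choose Suc i) = ((of_nat (Suc l) + 1) * of_nat ((k + j) choose i) / of_nat (Suc i) :: rat)"
    by (simp add: field_simps flip: of_nat_mult of_nat_add of_nat_Suc del: of_nat_Suc binomial_Suc_Suc)
  show ?thesis
    unfolding w_num_def j k diff_Suc_1 a b[unfolded j k]
    by (simp add: divide_simps algebra_simps del: of_nat_Suc binomial_Suc_Suc)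
qed

corollary w_num_in_Ints: "1 \<le> j \<Longrightarrow> j \<le> k \<Longrightarrow> w_num k j \<in> \<int>"
  by (simp add: w_num_eq_diff)

definition w_poly :: "nat \<Rightarrow> nat \<Rightarrow> rat poly" where
  "w_poly \<alpha> k = (\<Sum>j=1..k. monom (w_num k j ^ \<alpha>) (j - 1))"

(* \<int>[x], embedded in \<rat>[x] *)
definition int_polys :: "rat poly set" where
  "int_polys = range (map_poly of_int)"

end

theory Submission
  imports Defs "HOL-Computational_Algebra.Primes"
begin

text \<open>Put s = k + \<beta>. The numbers w(k, j) are values of polynomials in k invariant under k \<mapsto> -1 - k,
  so every coefficient of the k-th summand is an odd function F(s), divisible by the product of s + i
  over -\<beta> \<le> i \<le> \<beta>. It suffices to show, for each d with n \<le> d \<le> n + 2\<beta> + 1 and each prime power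
  p^a dividing d, that p^a divides the signed sum of F over -d \<le> s < d, counted negatively for s < 0.

  Think of w(s + i, j) as attached to the edge from s + i to s + i + 1 of the integer line, inside the
  window of vertices s - \<beta>, ..., s + \<beta>. On a residue class s = pq + k, removing the factors prime to
  p turns such a product into a product of the same kind in q: an edge inside a block between
  consecutive multiples of p becomes an edge function C(q, J) C(q + J, J), an edge touching a multiple of
  p becomes a function attached to that vertex, and the multiples of p in the window are the new
  vertices. The unit factors form an integer polynomial in pq. If the window contains a multiple of p,
  the weight yields a factor p and one descends to p^(a-1). Otherwise a function g(q) u(pq) with
  g(-1 - q) = g(q) remains. As u(X) - u(-p - X) is divisible by 2X + p, its signed sum is p times the
  sum of (2q + 1) g(q) v(pq), and this gains the missing factors p by induction.\<close>

text \<open>The sort constraint on the library's generalised binomial coefficient rules out integers.\<close>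

definition ichoose :: "int \<Rightarrow> nat \<Rightarrow> int" where
  "ichoose x k = (\<Prod>i=0..<k. x - int i) div fact k"

text \<open>The division in \<open>ichoose\<close> is exact, as the factorial divides a product of
  consecutive integers.\<close>

lemma fact_mult_ichoose: "fact k * ichoose x k = (\<Prod>i=0..<k. x - int i)"
proof -
  have "fact k dvd (\<Prod>i=0..<k. x - int i)"
    unfolding gbinomial_int_mult_fact[of k x, symmetric] by (rule dvd_triv_left)
  thus ?thesis by (simp add: ichoose_def)
qed

lemma ichoose_int: "ichoose (int n) k = int (n choose k)"
proof -
  have "fact k * int (n choose k) = fact k * ichoose (int n) k"
    unfolding fact_mult_ichoose gbinomial_int_mult_fact[symmetric] by (simp add: gbinomial_int_binomial)
  thus ?thesis by simp
qed

subsection \<open>Edge and vertex functions and their restriction to residue classes\<close>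

text \<open>Up to \<open>fact j * fact j\<close> this is the product of the 2j consecutive integers
  from x + 1 - j to x + j, centred at the midpoint of the edge from x to x + 1.\<close>

definition edge :: "nat \<Rightarrow> int \<Rightarrow> int" where
  "edge j x = ichoose x j * ichoose (x + int j) j"

text \<open>The product of the m integers just below x and the n just above it, without x itself,
  over the factorials of m and n.\<close>

definition vert :: "nat \<Rightarrow> nat \<Rightarrow> int \<Rightarrow> int" where
  "vert m n x = ichoose (x - 1) m * ichoose (x + int n) n"

text \<open>For k > 0 the value at k is w(k, j + 1) (index shifted by one), which is 0 for j \<ge> k.\<close>

definition little :: "nat \<Rightarrow> int \<Rightarrow> int" where
  "little j x = ichoose (x - 1) j * ichoose (x + int j + 1) (Suc j)
                - ichoose x (Suc j) * ichoose (x + int j + 1) j"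

section \<open>Numerators as products over sets of offsets\<close>

lemma fact_mult_ichoose_shift:
  "fact m * ichoose (x - c) m = (\<Prod>i\<in>{1 - c - int m..-c}. x + i :: int)"
proof -
  have "(\<Prod>i\<in>{1 - c - int m..-c}. x + i) = (\<Prod>i=0..<m. x - c - int i)"
    by (rule prod.reindex_bij_witness[of _ "\<lambda>i. - c - int i" "\<lambda>i. nat (- c - i)"]) auto
  thus ?thesis by (simp add: fact_mult_ichoose)
qed

lemma fact_mult_edge: "fact j * fact j * edge j x = (\<Prod>i\<in>{1 - int j..int j}. x + i)"
proof -
  have "{1 - int j..int j} = {1 - int j..0} \<union> {1..int j}" by auto
  hence "(\<Prod>i\<in>{1 - int j..int j}. x + i) = (\<Prod>i\<in>{1 - int j..0}. x + i) * (\<Prod>i\<in>{1..int j}. x + i)"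
    by (simp add: prod.union_disjoint)
  also have "\<dots> = (fact j * ichoose x j) * (fact j * ichoose (x + int j) j)"
    using fact_mult_ichoose_shift[of j x 0] fact_mult_ichoose_shift[of j x "- int j"] by simp
  finally show ?thesis by (simp add: edge_def mult_ac)
qed

lemma fact_mult_vert: "fact m * fact n * vert m n x = (\<Prod>i\<in>{- int m..int n} - {0}. x + i)"
proof -
  have "{- int m..int n} - {0} = {- int m..-1} \<union> {1..int n}" by auto
  hence "(\<Prod>i\<in>{- int m..int n} - {0}. x + i) = (\<Prod>i\<in>{- int m..-1}. x + i) * (\<Prod>i\<in>{1..int n}. x + i)"
    by (simp add: prod.union_disjoint)
  also have "\<dots> = (fact m * ichoose (x - 1) m) * (fact n * ichoose (x + int n) n)"
    using fact_mult_ichoose_shift[of m x 1] fact_mult_ichoose_shift[of n x "- int n"] by simp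
  finally show ?thesis by (simp add: vert_def mult_ac)
qed

text \<open>With a and b the products over \<open>{- int j..-1}\<close> and
  \<open>{2..int j + 1}\<close>, the two terms cleared of denominators are a (x + 1) b and x a b.
  Their difference is a b: the two end points of the edge drop out.\<close>

lemma fact_mult_little:
  "fact j * fact (Suc j) * little j x = (\<Prod>i\<in>{- int j..int j + 1} - {0, 1}. x + i)"
proof -
  let ?a = "\<Prod>i\<in>{- int j..-1}. x + i" and ?b = "\<Prod>i\<in>{2..int j + 1}. x + i"
  have "{- int j..int j + 1} - {0, 1} = {- int j..-1} \<union> {2..int j + 1}" by auto
  hence prod_eq: "(\<Prod>i\<in>{- int j..int j + 1} - {0, 1}. x + i) = ?a * ?b"
    by (simp add: prod.union_disjoint)
  have "{- int j..0} = insert 0 {- int j..-1}" "{1..int j + 1} = insert 1 {2..int j + 1}" by auto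
  hence ext: "(\<Prod>i\<in>{- int j..0}. x + i) = x * ?a" "(\<Prod>i\<in>{1..int j + 1}. x + i) = (x + 1) * ?b"
    by simp_all
  have 1: "fact j * ichoose (x - 1) j = ?a"
    using fact_mult_ichoose_shift[of j x 1] by simp
  have 2: "fact (Suc j) * ichoose (x + int j + 1) (Suc j) = (x + 1) * ?b"
  proof -
    have "x - (- int j - 1) = x + int j + 1" "1 - (- int j - 1) - int (Suc j) = 1"
      "- (- int j - 1) = int j + 1" by simp_all
    thus ?thesis using fact_mult_ichoose_shift[of "Suc j" x "- int j - 1"] ext(2) by metis
  qed
  have 3: "fact (Suc j) * ichoose x (Suc j) = x * ?a"
    using fact_mult_ichoose_shift[of "Suc j" x 0] ext by simp
  have 4: "fact j * ichoose (x + int j + 1) j = ?b"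
    using fact_mult_ichoose_shift[of j x "- int j - 1"] by (simp add: algebra_simps)
  have "fact j * fact (Suc j) * little j x
        = (fact j * ichoose (x - 1) j) * (fact (Suc j) * ichoose (x + int j + 1) (Suc j))
          - (fact (Suc j) * ichoose x (Suc j)) * (fact j * ichoose (x + int j + 1) j)"
    unfolding little_def by (simp only: right_diff_distrib mult_ac)
  also have "\<dots> = ?a * ?b" unfolding 1 2 3 4 by (simp add: algebra_simps)
  finally show ?thesis unfolding prod_eq .
qed

text \<open>The substitution of 1 - i for i negates every factor, and an even number of signs
  cancels.\<close>

lemma prod_reflect_even:
  fixes S :: "int set"
  assumes "finite S" "even (card S)" "\<And>i. i \<in> S \<Longrightarrow> 1 - i \<in> S"
  shows "(\<Prod>i\<in>S. (-1 - x) + i) = (\<Prod>i\<in>S. x + i)"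
proof -
  have "(\<Prod>i\<in>S. (-1 - x) + i) = (\<Prod>i\<in>S. (-1) * (x + i))"
    by (rule prod.reindex_bij_witness[of _ "\<lambda>i. 1 - i" "\<lambda>i. 1 - i"]) (use assms(3) in auto)
  also have "\<dots> = (-1) ^ card S * (\<Prod>i\<in>S. x + i)"
    by (simp only: prod.distrib prod_constant)
  finally show ?thesis using assms(2) by simp
qed

lemma edge_reflect: "edge j (-1 - x) = edge j x"
proof -
  have "fact j * fact j * edge j (-1 - x) = fact j * fact j * edge j x"
    unfolding fact_mult_edge by (rule prod_reflect_even) (auto simp: nat_mult_distrib)
  thus ?thesis by simp
qed

lemma little_reflect: "little j (-1 - x) = little j x"
proof -
  have "card ({- int j..int j + 1} - {0, 1}) = 2 * j"
    by (subst card_Diff_subset) auto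
  hence "fact j * fact (Suc j) * little j (-1 - x) = fact j * fact (Suc j) * little j x"
    unfolding fact_mult_little by (intro prod_reflect_even) auto
  thus ?thesis by simp
qed

section \<open>Restriction to residue classes modulo a prime\<close>

text \<open>The multiples of p up to m are p, 2p, ..., (m div p) p; the other factors form the unit
  d.\<close>

lemma fact_eq_prime_power_mult:
  assumes "prime p"
  shows "\<exists>d. coprime d (int p) \<and> (fact m :: int) = int p ^ (m div p) * fact (m div p) * d"
proof (induction m)
  case 0
  show ?case by (intro exI[of _ 1]) simp
next
  case (Suc m)
  then obtain d where d: "coprime d (int p)" "(fact m :: int) = int p ^ (m div p) * fact (m div p) * d"
    by blast
  have p: "p > 0" using assms by (simp add: prime_gt_0_nat)
  show ?case
  proof (cases "p dvd Suc m")
    case True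
    hence q: "Suc m div p = Suc (m div p)"
      using p by (simp add: div_Suc mod_eq_0_iff_dvd)
    have "int (Suc m) = int p * int (Suc (m div p))"
      using True q by (metis dvd_mult_div_cancel of_nat_mult)
    hence "(fact (Suc m) :: int) = int p ^ (Suc m div p) * fact (Suc m div p) * d"
      unfolding q fact_Suc d(2) by (simp del: of_nat_Suc)
    thus ?thesis using d(1) by blast
  next
    case False
    hence q: "Suc m div p = m div p" by (simp add: div_Suc mod_eq_0_iff_dvd)
    have "coprime (int (Suc m)) (int p)"
      using False assms by (metis coprime_commute coprime_int_iff prime_imp_coprime)
    hence "coprime (d * int (Suc m)) (int p)" using d(1) by simp
    moreover have "(fact (Suc m) :: int) = int p ^ (Suc m div p) * fact (Suc m div p) * (d * int (Suc m))"
      unfolding q fact_Suc d(2) by (simp del: of_nat_Suc)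
    ultimately show ?thesis by blast
  qed
qed

text \<open>The factors at the offsets p i - r equal p (q + i). All others go into the polynomial u,
  which may still take values divisible by p.\<close>

lemma prod_restrict_residue:
  fixes p r :: int
  assumes "finite S" "p \<noteq> 0" "\<And>i. i \<in> S' \<Longrightarrow> p * i - r \<in> S"
  shows "\<exists>u. \<forall>q. (\<Prod>i\<in>S. p * q + r + i) = p ^ card S' * (\<Prod>i\<in>S'. q + i) * poly u (p * q)"
proof -
  define I where "I = (\<lambda>i. p * i - r) ` S'"
  have I: "I \<subseteq> S" using assms(3) by (auto simp: I_def)
  have inj: "inj_on (\<lambda>i. p * i - r) S'" using assms(2) by (auto simp: inj_on_def)
  define u where "u = (\<Prod>i\<in>S - I. [:r + i, 1:])"
  have "(\<Prod>i\<in>S. p * q + r + i) = p ^ card S' * (\<Prod>i\<in>S'. q + i) * poly u (p * q)" for q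
  proof -
    have "(\<Prod>i\<in>S. p * q + r + i) = (\<Prod>i\<in>S - I. p * q + r + i) * (\<Prod>i\<in>I. p * q + r + i)"
      using I assms(1) by (rule prod.subset_diff)
    also have "(\<Prod>i\<in>I. p * q + r + i) = (\<Prod>i\<in>S'. p * (q + i))"
      unfolding I_def by (subst prod.reindex[OF inj]) (simp add: algebra_simps)
    also have "\<dots> = p ^ card S' * (\<Prod>i\<in>S'. q + i)" by (simp add: prod.distrib)
    also have "(\<Prod>i\<in>S - I. p * q + r + i) = poly u (p * q)"
      by (simp add: u_def poly_prod algebra_simps)
    finally show ?thesis by (simp add: mult_ac)
  qed
  thus ?thesis by blast
qed

text \<open>On the residue class of r, f agrees with g up to a factor d prime to p and a polynomial in pq.\<close>

definition restricts_to :: "int \<Rightarrow> (int \<Rightarrow> int) \<Rightarrow> int \<Rightarrow> (int \<Rightarrow> int) \<Rightarrow> bool" where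
  "restricts_to p f r g \<longleftrightarrow> (\<exists>d u. coprime d p \<and> (\<forall>q. d * f (p * q + r) = g q * poly u (p * q)))"

text \<open>c and c' are the factorial denominators. The last condition says that they differ by the
  extracted power of p, the unit d and an integer k, which is absorbed into the polynomial.\<close>

lemma restricts_toI:
  fixes p :: int
  assumes f: "\<And>x. c * f x = (\<Prod>i\<in>S. x + i)" and g: "\<And>x. c' * g x = (\<Prod>i\<in>S'. x + i)"
    and "finite S" "p \<noteq> 0" "\<And>i. i \<in> S' \<Longrightarrow> p * i - r \<in> S"
    and c: "c \<noteq> 0" and d: "coprime d p" "d * p ^ card S' * c' = k * c"
  shows "restricts_to p f r g"
proof -
  obtain u where u: "\<And>q. (\<Prod>i\<in>S. p * q + r + i) = p ^ card S' * (\<Prod>i\<in>S'. q + i) * poly u (p * q)"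
    using prod_restrict_residue[OF assms(3-5)] by blast
  have "d * f (p * q + r) = g q * poly (smult k u) (p * q)" for q
  proof -
    have "c * (d * f (p * q + r)) = d * (c * f (p * q + r))" by simp
    also have "\<dots> = (d * p ^ card S' * c') * g q * poly u (p * q)"
      unfolding f u g[symmetric] by (simp add: mult_ac)
    also have "\<dots> = c * (g q * poly (smult k u) (p * q))" unfolding d(2) by (simp add: mult_ac)
    finally show ?thesis using c by simp
  qed
  thus ?thesis using d(1) unfolding restricts_to_def by blast
qed

lemma restricts_to_shift:
  assumes "restricts_to p f r g"
  shows "restricts_to p f (p * i + r) (\<lambda>q. g (q + i))"
proof -
  obtain d u where *: "coprime d p" "\<And>q. d * f (p * q + r) = g q * poly u (p * q)"
    using assms unfolding restricts_to_def by blast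
  have "d * f (p * q + (p * i + r)) = g (q + i) * poly (pcompose u [:p * i, 1:]) (p * q)" for q
    using *(2)[of "q + i"] by (simp add: poly_pcompose algebra_simps)
  thus ?thesis using *(1) unfolding restricts_to_def by blast
qed

lemma restricts_to_mult:
  assumes "restricts_to p f r g" "restricts_to p f' r g'"
  shows "restricts_to p (\<lambda>x. f x * f' x) r (\<lambda>q. g q * g' q)"
proof -
  obtain d u where 1: "coprime d p" "\<And>q. d * f (p * q + r) = g q * poly u (p * q)"
    using assms unfolding restricts_to_def by blast
  obtain d' u' where 2: "coprime d' p" "\<And>q. d' * f' (p * q + r) = g' q * poly u' (p * q)"
    using assms unfolding restricts_to_def by blast
  have "d * d' * (f (p * q + r) * f' (p * q + r)) = g q * g' q * poly (u * u') (p * q)" for q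
  proof -
    have "d * d' * (f (p * q + r) * f' (p * q + r)) = (d * f (p * q + r)) * (d' * f' (p * q + r))"
      by (simp add: mult_ac)
    thus ?thesis unfolding 1(2) 2(2) by (simp add: mult_ac)
  qed
  moreover have "coprime (d * d') p" using 1(1) 2(1) by simp
  ultimately show ?thesis unfolding restricts_to_def by blast
qed

lemma mult_div_bounds:
  fixes p m :: nat
  assumes "p > 0"
  shows "int p * int (m div p) \<le> int m" "int m < int p * int (m div p) + int p"
proof -
  show "int p * int (m div p) \<le> int m"
    by (metis mult.commute div_times_less_eq_dividend of_nat_le_iff of_nat_mult)
  have "m < p * (m div p) + p"
    using assms dividend_less_times_div[of p m] by simp
  thus "int m < int p * int (m div p) + int p" by (metis of_nat_add of_nat_less_iff of_nat_mult)
qed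

text \<open>For 0 <= r < p the offsets p i - r with 1 - j div p <= i <= j div p all occur in
  \<open>edge j\<close>, and their 2 (j div p) factors p match the powers of p split off from the
  two factorials.\<close>

lemma edge_restrict:
  assumes "prime p" "0 \<le> r" "r < int p"
  shows "restricts_to (int p) (edge j) r (edge (j div p))"
proof -
  obtain d where d: "coprime d (int p)" "(fact j :: int) = int p ^ (j div p) * fact (j div p) * d"
    using fact_eq_prime_power_mult[OF assms(1)] by blast
  have p: "p > 0" using assms(1) by (simp add: prime_gt_0_nat)
  show ?thesis
  proof (rule restricts_toI[OF fact_mult_edge fact_mult_edge, where d = "d * d" and k = 1])
    fix i assume i: "i \<in> {1 - int (j div p)..int (j div p)}"
    \<comment> \<open>Naming the products with p leaves only linear inequalities.\<close>
    define y z where "y = int p * int (j div p)" "z = int p * i"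
    have "int p - y \<le> z" "z \<le> y"
      using i mult_left_mono[of "1 - int (j div p)" i "int p"] by (auto simp: y_z_def right_diff_distrib intro: mult_left_mono)
    thus "int p * i - r \<in> {1 - int j..int j}"
      using mult_div_bounds[OF p, of j, folded y_z_def] assms(2,3) by (simp flip: y_z_def)
  next
    show "d * d * int p ^ card {1 - int (j div p)..int (j div p)} * (fact (j div p) * fact (j div p))
          = 1 * (fact j * fact j)"
      unfolding d(2) by (simp add: nat_mult_distrib power_add flip: mult_2) (simp add: mult_2 power_add)
  qed (use d p in auto)
qed

lemma card_vert_nodes: "card ({- int m..int n} - {0}) = m + n"
  by (subst card_Diff_subset) auto

text \<open>At x = p q the omitted offset 0 corresponds to the omitted node 0, so the form of a
  vertex function is kept.\<close>

lemma vert_restrict_0: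
  assumes "prime p"
  shows "restricts_to (int p) (vert m n) 0 (vert (m div p) (n div p))"
proof -
  obtain d where d: "coprime d (int p)" "(fact m :: int) = int p ^ (m div p) * fact (m div p) * d"
    using fact_eq_prime_power_mult[OF assms(1)] by blast
  obtain e where e: "coprime e (int p)" "(fact n :: int) = int p ^ (n div p) * fact (n div p) * e"
    using fact_eq_prime_power_mult[OF assms(1)] by blast
  have p: "p > 0" using assms(1) by (simp add: prime_gt_0_nat)
  show ?thesis
  proof (rule restricts_toI[OF fact_mult_vert fact_mult_vert, where d = "d * e" and k = 1])
    fix i assume i: "i \<in> {- int (m div p)..int (n div p)} - {0}"
    define y y' z where "y = int p * int (m div p)" "y' = int p * int (n div p)" "z = int p * i"
    have "- y \<le> z" "z \<le> y'" "z \<noteq> 0"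
      using i p mult_left_mono[of "- int (m div p)" i "int p"] by (auto simp: y_y'_z_def)
    thus "int p * i - 0 \<in> {- int m..int n} - {0}"
      using mult_div_bounds[OF p, of m, folded y_y'_z_def] mult_div_bounds[OF p, of n, folded y_y'_z_def]
      by (simp flip: y_y'_z_def)
  next
    show "d * e * int p ^ card ({- int (m div p)..int (n div p)} - {0}) * (fact (m div p) * fact (n div p))
          = 1 * (fact m * fact n)"
      unfolding d(2) e(2) card_vert_nodes by (simp add: power_add mult_ac)
  qed (use d e p in auto)
qed

text \<open>If m and n straddle a multiple of p, the larger quotient still works: the surplus node
  contributes a factor p.\<close>
lemma fact_mult_fact_near_diagonal:
  assumes "prime p" "m \<le> Suc n" "n \<le> Suc m"
  defines "j \<equiv> max (m div p) (n div p)"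
  shows "\<exists>d k. coprime d (int p) \<and> d * int p ^ (2 * j) * (fact j * fact j) = k * (fact m * fact n)
               \<and> int p * int j \<le> int m + 1 \<and> int p * int j \<le> int n + 1"
proof -
  have p: "p > 0" using assms(1) by (simp add: prime_gt_0_nat)
  obtain d where d: "coprime d (int p)" "(fact m :: int) = int p ^ (m div p) * fact (m div p) * d"
    using fact_eq_prime_power_mult[OF assms(1)] by blast
  obtain e where e: "coprime e (int p)" "(fact n :: int) = int p ^ (n div p) * fact (n div p) * e"
    using fact_eq_prime_power_mult[OF assms(1)] by blast
  have "Suc n div p \<le> Suc (n div p)" "Suc m div p \<le> Suc (m div p)" by (simp_all add: div_Suc)
  moreover have "m div p \<le> Suc n div p" "n div p \<le> Suc m div p" using assms(2,3) by (simp_all add: div_le_mono)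
  ultimately have "m div p \<le> Suc (n div p)" "n div p \<le> Suc (m div p)" by linarith+
  then consider "m div p = n div p" | "m div p = Suc (n div p)" | "n div p = Suc (m div p)" by linarith
  hence "\<exists>k. d * e * int p ^ (2 * j) * (fact j * fact j) = k * (fact m * fact n)"
  proof cases
    case 1
    hence "d * e * int p ^ (2 * j) * (fact j * fact j) = 1 * (fact m * fact n)"
      unfolding d(2) e(2) j_def by (simp add: mult_2 power_add)
    thus ?thesis ..
  next
    case 2
    hence j: "j = Suc (n div p)" by (simp add: j_def)
    have "d * e * int p ^ (2 * j) * (fact j * fact j) = (int p * int j) * (fact m * fact n)"
      unfolding d(2) e(2) 2 j
      by (simp only: mult_2 add_Suc add_Suc_right power_Suc power_add fact_Suc mult_ac)
    thus ?thesis ..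
  next
    case 3
    hence j: "j = Suc (m div p)" by (simp add: j_def)
    have "d * e * int p ^ (2 * j) * (fact j * fact j) = (int p * int j) * (fact m * fact n)"
      unfolding d(2) e(2) 3 j
      by (simp only: mult_2 add_Suc add_Suc_right power_Suc power_add fact_Suc mult_ac)
    thus ?thesis ..
  qed
  moreover have "int p * int j \<le> int m + 1" "int p * int j \<le> int n + 1"
    using mult_div_bounds(1)[OF p, of m] mult_div_bounds(1)[OF p, of n] assms(2,3)
    by (auto simp: j_def max_def)
  moreover have "coprime (d * e) (int p)" using d(1) e(1) by simp
  ultimately show ?thesis by blast
qed

text \<open>Since p does not divide r, the omitted offset 0 is not of the form p i - r: no node is
  lost, and the nodes fill an interval as for an edge function.\<close>

lemma vert_restrict_edge:
  assumes "prime p" "m \<le> Suc n" "n \<le> Suc m" "0 < r" "r < int p"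
  shows "\<exists>j. restricts_to (int p) (vert m n) r (edge j)"
proof -
  define j where "j = max (m div p) (n div p)"
  obtain d k where d: "coprime d (int p)" "d * int p ^ (2 * j) * (fact j * fact j) = k * (fact m * fact n)"
    and b: "int p * int j \<le> int m + 1" "int p * int j \<le> int n + 1"
    using fact_mult_fact_near_diagonal[OF assms(1-3)] unfolding j_def by blast
  have p: "p > 0" using assms(1) by (simp add: prime_gt_0_nat)
  have "restricts_to (int p) (vert m n) r (edge j)"
  proof (rule restricts_toI[OF fact_mult_vert fact_mult_edge, where d = d and k = k])
    fix i assume i: "i \<in> {1 - int j..int j}"
    define y z where "y = int p * int j" "z = int p * i"
    have "int p - y \<le> z" "z \<le> y"
      using i mult_left_mono[of "1 - int j" i "int p"] by (auto simp: y_z_def right_diff_distrib intro: mult_left_mono)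
    moreover have "z \<noteq> r"
      using zdvd_not_zless[OF assms(4,5)] unfolding y_z_def by (metis dvd_triv_left)
    ultimately show "int p * i - r \<in> {- int m..int n} - {0}"
      using b[folded y_z_def] assms(4,5) by (simp flip: y_z_def)
  next
    have "card {1 - int j..int j} = 2 * j" by simp
    thus "d * int p ^ card {1 - int j..int j} * (fact j * fact j) = k * (fact m * fact n)"
      using d(2) by simp
  qed (use d p in auto)
  thus ?thesis ..
qed

text \<open>Neither end point of the edge is a multiple of p, so neither omitted offset is a
  node.\<close>

lemma little_restrict_edge:
  assumes "prime p" "0 < r" "r < int p - 1"
  shows "\<exists>i. restricts_to (int p) (little j) r (edge i)"
proof -
  define i where "i = max (j div p) (Suc j div p)"
  obtain d k where d: "coprime d (int p)" "d * int p ^ (2 * i) * (fact i * fact i) = k * (fact j * fact (Suc j))"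
    and b: "int p * int i \<le> int j + 1" "int p * int i \<le> int (Suc j) + 1"
    using fact_mult_fact_near_diagonal[OF assms(1), of j "Suc j"] unfolding i_def by auto
  have p: "p > 0" using assms(1) by (simp add: prime_gt_0_nat)
  have "restricts_to (int p) (little j) r (edge i)"
  proof (rule restricts_toI[OF fact_mult_little fact_mult_edge, where d = d and k = k])
    fix l assume l: "l \<in> {1 - int i..int i}"
    define y z where "y = int p * int i" "z = int p * l"
    have "int p - y \<le> z" "z \<le> y"
      using l mult_left_mono[of "1 - int i" l "int p"] by (auto simp: y_z_def right_diff_distrib intro: mult_left_mono)
    moreover have "z \<noteq> r" "z \<noteq> r + 1"
    proof -
      have "\<not> int p dvd r" "\<not> int p dvd r + 1"
        using zdvd_not_zless[of r "int p"] zdvd_not_zless[of "r + 1" "int p"] assms by auto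
      thus "z \<noteq> r" "z \<noteq> r + 1" unfolding y_z_def by (metis dvd_triv_left)+
    qed
    ultimately show "int p * l - r \<in> {- int j..int j + 1} - {0, 1}"
      using b[folded y_z_def] assms(2,3) by (auto simp flip: y_z_def)
  next
    have "card {1 - int i..int i} = 2 * i" by simp
    thus "d * int p ^ card {1 - int i..int i} * (fact i * fact i) = k * (fact j * fact (Suc j))"
      using d(2) by simp
  qed (use d p in auto)
  thus ?thesis ..
qed

text \<open>The lower end point is the multiple of p. Its omission leaves the gap of a vertex
  function, while the omitted offset 1 is no multiple of p.\<close>

lemma little_restrict_0:
  assumes "prime p"
  shows "restricts_to (int p) (little j) 0 (vert (j div p) (Suc j div p))"
proof -
  obtain d where d: "coprime d (int p)" "(fact j :: int) = int p ^ (j div p) * fact (j div p) * d"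
    using fact_eq_prime_power_mult[OF assms(1)] by blast
  obtain e where e: "coprime e (int p)"
      "(fact (Suc j) :: int) = int p ^ (Suc j div p) * fact (Suc j div p) * e"
    using fact_eq_prime_power_mult[OF assms(1)] by blast
  have p: "p > 1" using assms(1) by (rule prime_gt_1_nat)
  show ?thesis
  proof (rule restricts_toI[OF fact_mult_little fact_mult_vert, where d = "d * e" and k = 1])
    fix i assume i: "i \<in> {- int (j div p)..int (Suc j div p)} - {0}"
    define y y' z where "y = int p * int (j div p)" "y' = int p * int (Suc j div p)" "z = int p * i"
    have "- y \<le> z" "z \<le> y'" "z \<noteq> 0" "z \<noteq> 1"
      using i p mult_left_mono[of "- int (j div p)" i "int p"] by (auto simp: y_y'_z_def zmult_eq_1_iff)
    thus "int p * i - 0 \<in> {- int j..int j + 1} - {0, 1}"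
      using mult_div_bounds[of p j, folded y_y'_z_def] mult_div_bounds[of p "Suc j", folded y_y'_z_def] p
      by (simp flip: y_y'_z_def)
  next
    show "d * e * int p ^ card ({- int (j div p)..int (Suc j div p)} - {0}) * (fact (j div p) * fact (Suc j div p))
          = 1 * (fact j * fact (Suc j))"
      unfolding d(2) e(2) card_vert_nodes by (simp only: power_add mult_ac)
  qed (use d e p in auto)
qed

text \<open>Mirror image, with the upper end point as the multiple of p. The residue is written -1
  instead of p - 1 so that this end point is p q.\<close>

lemma little_restrict_minus_1:
  assumes "prime p"
  shows "restricts_to (int p) (little j) (-1) (vert (Suc j div p) (j div p))"
proof -
  obtain d where d: "coprime d (int p)" "(fact j :: int) = int p ^ (j div p) * fact (j div p) * d"
    using fact_eq_prime_power_mult[OF assms(1)] by blast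
  obtain e where e: "coprime e (int p)"
      "(fact (Suc j) :: int) = int p ^ (Suc j div p) * fact (Suc j div p) * e"
    using fact_eq_prime_power_mult[OF assms(1)] by blast
  have p: "p > 1" using assms(1) by (rule prime_gt_1_nat)
  show ?thesis
  proof (rule restricts_toI[OF fact_mult_little fact_mult_vert, where d = "d * e" and k = 1])
    fix i assume i: "i \<in> {- int (Suc j div p)..int (j div p)} - {0}"
    define y y' z where "y = int p * int (Suc j div p)" "y' = int p * int (j div p)" "z = int p * i"
    have "- y \<le> z" "z \<le> y'" "z \<noteq> 0"
      using i p mult_left_mono[of "- int (Suc j div p)" i "int p"] by (auto simp: y_y'_z_def)
    moreover have "z \<noteq> -1"
      using p zmult_eq_1_iff[of "int p" "- i"] by (auto simp: y_y'_z_def)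
    ultimately show "int p * i - (-1) \<in> {- int j..int j + 1} - {0, 1}"
      using mult_div_bounds[of p j, folded y_y'_z_def] mult_div_bounds[of p "Suc j", folded y_y'_z_def] p
      by (simp flip: y_y'_z_def)
  next
    show "d * e * int p ^ card ({- int (Suc j div p)..int (j div p)} - {0}) * (fact (Suc j div p) * fact (j div p))
          = 1 * (fact j * fact (Suc j))"
      unfolding d(2) e(2) card_vert_nodes by (simp only: power_add mult_ac)
  qed (use d e p in auto)
qed

subsection \<open>Products over a window\<close>

text \<open>A window consists of the vertices l, ..., h - 1, and edge i joins i to i + 1. The two outer edges
  l - 1 and h - 1 may carry edge functions, but not the little Schroeder factors, whose restrictions can
  live on either end point.\<close>

inductive_set win :: "int \<Rightarrow> int \<Rightarrow> (int \<Rightarrow> int) set" for l h :: int where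
  one: "(\<lambda>x. 1) \<in> win l h"
| edge: "F \<in> win l h \<Longrightarrow> l - 1 \<le> i \<Longrightarrow> i < h \<Longrightarrow> (\<lambda>x. edge j (x + i) * F x) \<in> win l h"
| vert: "F \<in> win l h \<Longrightarrow> l \<le> i \<Longrightarrow> i < h \<Longrightarrow> m \<le> Suc n \<Longrightarrow> n \<le> Suc m
         \<Longrightarrow> (\<lambda>x. vert m n (x + i) * F x) \<in> win l h"
| little: "F \<in> win l h \<Longrightarrow> l \<le> i \<Longrightarrow> i + 1 < h \<Longrightarrow> (\<lambda>x. little j (x + i) * F x) \<in> win l h"

lemma win_mult:
  assumes "F \<in> win l h" "G \<in> win l h"
  shows "(\<lambda>x. F x * G x) \<in> win l h"
  using assms(1) by induction (simp_all add: assms(2) mult.assoc win.intros)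

lemma restricts_to_translate:
  "restricts_to p (\<lambda>x. f (x + i)) k g \<longleftrightarrow> restricts_to p f (k + i) g"
  by (simp add: restricts_to_def add.assoc)

text \<open>Keeps the condition that m and n differ by at most one when both are divided by
  p.\<close>

lemma div_le_Suc_div:
  fixes m n p :: nat
  assumes "m \<le> Suc n"
  shows "m div p \<le> Suc (n div p)"
proof -
  have "m div p \<le> Suc n div p" using assms by (rule div_le_mono)
  also have "\<dots> \<le> Suc (n div p)" by (simp add: div_Suc)
  finally show ?thesis .
qed

text \<open>For x = p q + k the multiples of p in the window are p (q + i) with k + l <= p i <= k +
  h - 1. Rounding gives the half-open bounds of the new window.\<close>

lemma win_restrict:
  fixes p :: nat and k :: int
  assumes p: "prime p" and F: "F \<in> win l h"
  shows "\<exists>G \<in> win ((k + l - 1) div int p + 1) ((k + h - 1) div int p + 1). restricts_to (int p) F k G"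
    (is "\<exists>G \<in> win ?l ?h. _")
  using F
proof induction
  case one
  have "restricts_to (int p) (\<lambda>x. 1) k (\<lambda>x. 1)"
    unfolding restricts_to_def by (intro exI[of _ 1]) simp
  thus ?case using win.one by blast
next
  have p0: "int p > 0" using p by (simp add: prime_gt_0_nat)
  have pos: "?l - 1 \<le> (k + i) div int p" if "l - 1 \<le> i" for i
    using that p0 by (simp add: zdiv_mono1)
  have posh: "(k + i) div int p < ?h" if "i < h" for i
    using that p0 zdiv_mono1[of "k + i" "k + h - 1" "int p"] by simp
  \<comment> \<open>On a multiple of p the lower bound improves by one, from the outer edge to the
    first vertex.\<close>
  have pos0: "?l \<le> (k + i) div int p" if "l \<le> i" "(k + i) mod int p = 0" for i
  proof -
    have "(k + l - 1) div int p \<le> (k + i - 1) div int p" using that p0 by (simp add: zdiv_mono1)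
    also have "k + i - 1 = -1 + int p * ((k + i) div int p)"
      using that(2) mult_div_mod_eq[of "int p" "k + i"] by linarith
    also have "\<dots> div int p = (k + i) div int p - 1"
      using p0 by (subst div_mult_self2) (auto simp: div_eq_minus1)
    finally show ?thesis by simp
  qed
  have sh: "restricts_to (int p) (\<lambda>x. f (x + i)) k (\<lambda>q. g (q + (k + i) div int p))"
    if "restricts_to (int p) f ((k + i) mod int p) g" for f g i
    using restricts_to_shift[OF that, of "(k + i) div int p"] by (simp add: restricts_to_translate)
  have r: "0 \<le> (k + i) mod int p" "(k + i) mod int p < int p" for i
    using p0 by simp_all
  {
    case (edge F i j)
    obtain G where G: "G \<in> win ?l ?h" "restricts_to (int p) F k G" using edge.IH by blast
    have "restricts_to (int p) (\<lambda>x. edge j (x + i) * F x) k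
            (\<lambda>q. edge (j div p) (q + (k + i) div int p) * G q)"
      by (rule restricts_to_mult[OF sh[OF edge_restrict[OF p r]] G(2)])
    moreover have "(\<lambda>q. edge (j div p) (q + (k + i) div int p) * G q) \<in> win ?l ?h"
      using edge.hyps by (intro win.edge G pos posh)
    ultimately show ?case by blast
  next
    case (vert F i m n)
    obtain G where G: "G \<in> win ?l ?h" "restricts_to (int p) F k G" using vert.IH by blast
    show ?case
    proof (cases "(k + i) mod int p = 0")
      case True
      have "restricts_to (int p) (\<lambda>x. vert m n (x + i)) k
            (\<lambda>q. vert (m div p) (n div p) (q + (k + i) div int p))"
        by (rule sh) (use vert_restrict_0[OF p] True in simp)
      hence "restricts_to (int p) (\<lambda>x. vert m n (x + i) * F x) k
            (\<lambda>q. vert (m div p) (n div p) (q + (k + i) div int p) * G q)"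
        by (rule restricts_to_mult[OF _ G(2)])
      moreover have "(\<lambda>q. vert (m div p) (n div p) (q + (k + i) div int p) * G q) \<in> win ?l ?h"
        using vert.hyps True by (intro win.vert G pos0 posh div_le_Suc_div)
      ultimately show ?thesis by blast
    next
      case False
      then obtain j where "restricts_to (int p) (vert m n) ((k + i) mod int p) (edge j)"
        using vert_restrict_edge[OF p vert.hyps(4,5), of "(k + i) mod int p"] r[of i] by force
      hence "restricts_to (int p) (\<lambda>x. vert m n (x + i) * F x) k
            (\<lambda>q. edge j (q + (k + i) div int p) * G q)"
        by (intro restricts_to_mult[OF _ G(2)] sh)
      moreover have "(\<lambda>q. edge j (q + (k + i) div int p) * G q) \<in> win ?l ?h"
        using vert.hyps by (intro win.edge G pos posh) auto
      ultimately show ?thesis by blast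
    qed
  next
    case (little F i j)
    obtain G where G: "G \<in> win ?l ?h" "restricts_to (int p) F k G" using little.IH by blast
    consider "(k + i) mod int p = 0" | "(k + i) mod int p = int p - 1"
      | "0 < (k + i) mod int p" "(k + i) mod int p < int p - 1"
      using r[of i] by linarith
    thus ?case
    proof cases
      case 1
      have "restricts_to (int p) (\<lambda>x. little j (x + i)) k
            (\<lambda>q. vert (j div p) (Suc j div p) (q + (k + i) div int p))"
        by (rule sh) (use little_restrict_0[OF p] 1 in simp)
      hence "restricts_to (int p) (\<lambda>x. little j (x + i) * F x) k
            (\<lambda>q. vert (j div p) (Suc j div p) (q + (k + i) div int p) * G q)"
        by (rule restricts_to_mult[OF _ G(2)])
      moreover have "(\<lambda>q. vert (j div p) (Suc j div p) (q + (k + i) div int p) * G q) \<in> win ?l ?h"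
        using little.hyps 1 by (intro win.vert G pos0 posh div_le_Suc_div) (auto simp: div_le_mono le_SucI)
      ultimately show ?thesis by blast
    next
      case 2
      \<comment> \<open>The multiple of p is the upper end point k + i + 1, so the factor belongs to
        the vertex after the edge; i + 1 < h keeps it in the window.\<close>
      define i' where "i' = (k + i) div int p + 1"
      have ki: "k + i = int p * i' + (-1)"
        using 2 mult_div_mod_eq[of "int p" "k + i"] unfolding i'_def distrib_left by linarith
      have i': "i' = (k + (i + 1)) div int p"
        using ki p0 by (simp add: add.assoc[symmetric])
      have "restricts_to (int p) (\<lambda>x. little j (x + i)) k (\<lambda>q. vert (Suc j div p) (j div p) (q + i'))"
        unfolding restricts_to_translate ki by (rule restricts_to_shift[OF little_restrict_minus_1[OF p]])
      hence "restricts_to (int p) (\<lambda>x. little j (x + i) * F x) k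
            (\<lambda>q. vert (Suc j div p) (j div p) (q + i') * G q)"
        by (rule restricts_to_mult[OF _ G(2)])
      moreover have "(\<lambda>q. vert (Suc j div p) (j div p) (q + i') * G q) \<in> win ?l ?h"
      proof (intro win.vert G)
        show "?l \<le> i'" using pos[of i] little.hyps unfolding i'_def by simp
        show "i' < ?h" unfolding i' using little.hyps by (intro posh) simp
      qed (auto simp: div_le_mono le_SucI div_le_Suc_div)
      ultimately show ?thesis by blast
    next
      case 3
      then obtain j' where "restricts_to (int p) (little j) ((k + i) mod int p) (edge j')"
        using little_restrict_edge[OF p] by blast
      hence "restricts_to (int p) (\<lambda>x. little j (x + i) * F x) k
            (\<lambda>q. edge j' (q + (k + i) div int p) * G q)"
        by (intro restricts_to_mult[OF _ G(2)] sh)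
      moreover have "(\<lambda>q. edge j' (q + (k + i) div int p) * G q) \<in> win ?l ?h"
        using little.hyps by (intro win.edge G pos posh) auto
      ultimately show ?thesis by blast
    qed
  }
qed

subsection \<open>Signed sums\<close>

text \<open>The signs cancel the part of F that is invariant under q to -1 - q, and each half splits
  into residue classes by itself.\<close>

definition ssum :: "int \<Rightarrow> (int \<Rightarrow> int) \<Rightarrow> int" where
  "ssum M F = (\<Sum>q\<in>{0..<M}. F q) - (\<Sum>q\<in>{-M..<0}. F q)"

lemma int_div_less_iff:
  fixes x p b :: int
  assumes "p > 0"
  shows "x div p < b \<longleftrightarrow> x < p * b"
proof -
  have "b \<le> x div p" if "p * b \<le> x" using zdiv_mono1[OF that assms] assms by simp
  moreover have "p * b \<le> x" if "b \<le> x div p"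
  proof -
    have "p * b \<le> p * (x div p)" using that assms by simp
    also have "\<dots> \<le> x" using mult_div_mod_eq[of p x] pos_mod_sign[OF assms, of x] by linarith
    finally show ?thesis .
  qed
  ultimately show ?thesis by linarith
qed

lemma sum_residues:
  fixes p :: int
  assumes "p > 0"
  shows "(\<Sum>x\<in>{p * a..<p * b}. F x) = (\<Sum>k\<in>{0..<p}. \<Sum>q\<in>{a..<b}. F (p * q + k))"
proof -
  have "(\<Sum>k\<in>{0..<p}. \<Sum>q\<in>{a..<b}. F (p * q + k))
        = (\<Sum>(k, q)\<in>{0..<p} \<times> {a..<b}. F (p * q + k))"
    by (rule sum.cartesian_product)
  also have "\<dots> = (\<Sum>x\<in>{p * a..<p * b}. F x)"
  proof (rule sum.reindex_bij_witness[of _ "\<lambda>x. (x mod p, x div p)" "\<lambda>(k, q). p * q + k"])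
    fix kq assume "kq \<in> {0..<p} \<times> {a..<b}"
    then obtain k q where kq: "kq = (k, q)" "0 \<le> k" "k < p" "a \<le> q" "q < b" by auto
    have "p * a \<le> p * q + k"
      using kq assms mult_left_mono[of a q p] by linarith
    moreover have "p * q + k < p * b"
      using kq assms mult_left_mono[of "q + 1" b p, unfolded distrib_left] by linarith
    ultimately show "(case kq of (k, q) \<Rightarrow> p * q + k) \<in> {p * a..<p * b}"
      using kq by simp
  next
    fix x assume x: "x \<in> {p * a..<p * b}"
    have "a \<le> x div p" using x assms zdiv_mono1[of "p * a" x p] by simp
    moreover have "x div p < b"
      using x assms by (simp add: int_div_less_iff)
    ultimately show "(x mod p, x div p) \<in> {0..<p} \<times> {a..<b}" using assms by simp
  qed (use assms in auto)
  finally show ?thesis ..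
qed

lemma ssum_residues:
  assumes "p > 0"
  shows "ssum (p * M) F = (\<Sum>k\<in>{0..<p}. ssum M (\<lambda>q. F (p * q + k)))"
  using sum_residues[OF assms, of F 0 M] sum_residues[OF assms, of F "-M" 0]
  by (simp add: ssum_def sum_subtractf)

lemma ssum_mult_left: "ssum M (\<lambda>x. c * F x) = c * ssum M F"
  by (simp add: ssum_def sum_distrib_left right_diff_distrib)

lemma ssum_add: "ssum M (\<lambda>x. F x + G x) = ssum M F + ssum M G"
  by (simp add: ssum_def sum.distrib)

text \<open>The unit d may be multiplied in and cancelled again; its polynomial is absorbed into the
  arbitrary v, hence the premise for all u.\<close>

lemma restricts_to_dvd_ssum:
  assumes "restricts_to p F k G" "\<And>u. p ^ e dvd ssum M (\<lambda>q. G q * (W q * poly u (p * q)))"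
  shows "p ^ e dvd ssum M (\<lambda>q. F (p * q + k) * (W q * poly v (p * q)))"
proof -
  obtain d u where d: "coprime d p" "\<And>q. d * F (p * q + k) = G q * poly u (p * q)"
    using assms(1) unfolding restricts_to_def by blast
  have "d * ssum M (\<lambda>q. F (p * q + k) * (W q * poly v (p * q)))
        = ssum M (\<lambda>q. G q * (W q * poly (u * v) (p * q)))"
    unfolding ssum_mult_left[symmetric] mult.assoc[symmetric] d(2) by (simp add: mult_ac)
  hence "p ^ e dvd d * ssum M (\<lambda>q. F (p * q + k) * (W q * poly v (p * q)))"
    using assms(2)[of "u * v"] by simp
  moreover have "coprime (p ^ e) d" using d(1) by (simp add: coprime_commute)
  ultimately show ?thesis using coprime_dvd_mult_right_iff by blast
qed

lemma ssum_reflect: "ssum M F = (\<Sum>q\<in>{0..<M}. F q - F (-1 - q))"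
proof -
  have "(\<Sum>q\<in>{-M..<0}. F q) = (\<Sum>q\<in>{0..<M}. F (-1 - q))"
    by (rule sum.reindex_bij_witness[of _ "\<lambda>q. -1 - q" "\<lambda>q. -1 - q"]) auto
  thus ?thesis by (simp add: ssum_def sum_subtractf)
qed

section \<open>Windows without vertices\<close>

text \<open>An empty window admits only edge functions at i = 0, and these are invariant under the
  reflection.\<close>

lemma win_1_1_even:
  assumes "F \<in> win 1 1"
  shows "F (-1 - x) = F x"
  using assms
proof induction
  case (edge F i j)
  hence "i = 0" by simp
  thus ?case using edge.IH edge_reflect[of j x] by simp
qed auto

text \<open>A difference u(x) - u(y) is divisible by x - y, here with y = - p - x; the induction
  keeps the quotient integral.\<close>

lemma poly_diff_reflect:
  fixes u :: "int poly"
  shows "\<exists>w. \<forall>x. poly u x - poly u (- p - x) = (2 * x + p) * poly w x"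
proof (induction u)
  case 0
  show ?case by (intro exI[of _ 0]) simp
next
  case (pCons a u)
  then obtain w where w: "\<And>x. poly u x - poly u (- p - x) = (2 * x + p) * poly w x" by blast
  have "poly (pCons a u) x - poly (pCons a u) (- p - x)
        = (2 * x + p) * poly ([:0, 1:] * w + pcompose u [:- p, -1:]) x" for x
  proof -
    have "poly (pCons a u) x - poly (pCons a u) (- p - x)
          = x * (poly u x - poly u (- p - x)) + (2 * x + p) * poly u (- p - x)"
      by (simp add: algebra_simps)
    also have "\<dots> = (2 * x + p) * poly ([:0, 1:] * w + pcompose u [:- p, -1:]) x"
      unfolding w by (simp add: poly_pcompose algebra_simps)
    finally show ?thesis .
  qed
  thus ?case by blast
qed

text \<open>As F is even, pairing q with -1 - q leaves F(q) (u(pq) - u(-p - pq)), and the divisor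
  2pq + p yields the factor p. The cofactor of F that remains is odd under the reflection, which
  allows the next descent step.\<close>

lemma win_1_1_odd_reduction:
  fixes p :: nat
  assumes p: "prime p" and F: "F \<in> win 1 1"
  obtains w where "\<And>q. (2 * (-1 - q) + 1) * poly w (int p * (-1 - q)) = - ((2 * q + 1) * poly w (int p * q))"
    and "\<And>N. ssum N (\<lambda>q. F q * poly u (int p * q))
             = int p * (\<Sum>q\<in>{0..<N}. F q * ((2 * q + 1) * poly w (int p * q)))"
proof -
  have p0: "int p > 0" using p by (simp add: prime_gt_0_nat)
  obtain w where w: "\<And>x. poly u x - poly u (- int p - x) = (2 * x + int p) * poly w x"
    using poly_diff_reflect by blast
  have w_sym: "poly w (int p * (-1 - q)) = poly w (int p * q)" for q
  proof -
    \<comment> \<open>2q + 1 is odd, hence nonzero, so the divisor can be cancelled.\<close>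
    have nz: "2 * (int p * q) + int p \<noteq> 0"
    proof
      assume "2 * (int p * q) + int p = 0"
      hence "int p * (2 * q + 1) = 0" by (simp add: algebra_simps)
      thus False using p0 by simp presburger
    qed
    have "int p * (-1 - q) = - int p - int p * q" by (simp add: algebra_simps)
    hence "(2 * (int p * q) + int p) * poly w (int p * (-1 - q))
        = (2 * (int p * q) + int p) * poly w (int p * q)"
      using w[of "int p * q"] w[of "- int p - int p * q"] by (simp add: algebra_simps)
    thus ?thesis using nz by simp
  qed
  have red: "ssum N (\<lambda>q. F q * poly u (int p * q)) = int p * (\<Sum>q\<in>{0..<N}. F q * ((2 * q + 1) * poly w (int p * q)))" for N
  proof -
    have "F q * poly u (int p * q) - F (-1 - q) * poly u (int p * (-1 - q)) = int p * (F q * ((2 * q + 1) * poly w (int p * q)))" for q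
    proof -
      have "int p * (-1 - q) = - int p - int p * q" by (simp add: algebra_simps)
      hence "F q * poly u (int p * q) - F (-1 - q) * poly u (int p * (-1 - q))
             = F q * (poly u (int p * q) - poly u (- int p - int p * q))"
        by (simp add: win_1_1_even[OF F] right_diff_distrib)
      thus ?thesis unfolding w by (simp add: algebra_simps)
    qed
    thus ?thesis unfolding ssum_reflect by (simp add: sum_distrib_left)
  qed
  show ?thesis
    by (rule that[OF _ red]) (unfold w_sym, simp add: algebra_simps)
qed

text \<open>A window without vertices: the extra factor p compensates for the missing weight.\<close>

lemma win_1_1_ssum_dvd:
  fixes p :: nat
  assumes p: "prime p"
  shows "F \<in> win 1 1
     \<Longrightarrow> int p ^ Suc a dvd ssum (int p ^ a * M) (\<lambda>q. F q * poly u (int p * q))"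
proof (induction a arbitrary: F u M)
  case (0 F u M)
  then obtain w where "ssum M (\<lambda>q. F q * poly u (int p * q))
      = int p * (\<Sum>q\<in>{0..<M}. F q * ((2 * q + 1) * poly w (int p * q)))"
    using win_1_1_odd_reduction[OF p, of F u] by blast
  thus ?case by simp
next
  case (Suc a F u M)
  have p0: "int p > 0" using p by (simp add: prime_gt_0_nat)
  note F = Suc.prems
  obtain w where w: "\<And>q. (2 * (-1 - q) + 1) * poly w (int p * (-1 - q)) = - ((2 * q + 1) * poly w (int p * q))"
    and red0: "\<And>N. ssum N (\<lambda>q. F q * poly u (int p * q))
             = int p * (\<Sum>q\<in>{0..<N}. F q * ((2 * q + 1) * poly w (int p * q)))"
    using win_1_1_odd_reduction[OF p F, of u] by blast
  define E where "E q = F q * ((2 * q + 1) * poly w (int p * q))" for q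
  note red = red0[folded E_def]
  have E_odd: "E (-1 - q) = - E q" for q
    unfolding E_def w win_1_1_even[OF F] by simp
  have part: "int p ^ Suc a dvd ssum (int p ^ a * M) (\<lambda>q. E (int p * q + k))"
    if k: "k \<in> {0..<int p}" for k
  proof -
    \<comment> \<open>The empty window restricts to an empty window, so every class stays within the
      induction hypothesis.\<close>
    have "(k + 1 - 1) div int p + 1 = 1" using k by simp
    then obtain G where G: "G \<in> win 1 1" "restricts_to (int p) F k G"
      using win_restrict[OF p F, of k] by auto
    \<comment> \<open>As a polynomial in X = p q, the odd factor at p q + k is (2 X + 2 k + 1) w(p X
      + p k).\<close>
    have "int p ^ Suc a dvd ssum (int p ^ a * M)
      (\<lambda>q. F (int p * q + k) * (1 * poly ([:2 * k + 1, 2:] * pcompose w [:int p * k, int p:]) (int p * q)))"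
      by (rule restricts_to_dvd_ssum[OF G(2)]) (use Suc.IH[OF G(1)] in simp)
    thus ?thesis by (simp add: E_def poly_pcompose algebra_simps)
  qed
  define S where "S = (\<Sum>q\<in>{0..<int p ^ Suc a * M}. E q)"
  have "int p ^ Suc a dvd S"
  \<comment> \<open>For odd p the half sum S is recovered from the signed sum 2 S; for p = 2 the two residue classes
    of S are exchanged by the reflection and combine to a signed sum over a single class.\<close>
  proof (cases "p = 2")
    case True
    have "S = (\<Sum>q\<in>{0..<2 ^ a * M}. E (2 * q) + E (2 * q + 1))"
    proof -
      have "S = (\<Sum>k\<in>{0..<2}. \<Sum>q\<in>{0..<2 ^ a * M}. E (2 * q + k))"
        using sum_residues[of 2 E 0 "2 ^ a * M"] by (simp add: S_def True mult.assoc)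
      moreover have "{0..<2::int} = {0, 1}" by auto
      ultimately show ?thesis by (simp add: sum.distrib)
    qed
    also have "\<dots> = ssum (2 ^ a * M) (\<lambda>q. E (2 * q))"
    proof -
      have "E (2 * q + 1) = - E (2 * (-1 - q))" for q
        using E_odd[of "2 * q + 1"] by (simp add: algebra_simps)
      thus ?thesis by (simp add: ssum_reflect)
    qed
    finally show ?thesis using part[of 0] True by simp
  next
    case False
    have "2 * S = ssum (int p ^ Suc a * M) E"
      unfolding ssum_reflect E_odd S_def by (simp add: sum_distrib_left)
    also have "\<dots> = (\<Sum>k\<in>{0..<int p}. ssum (int p ^ a * M) (\<lambda>q. E (int p * q + k)))"
      using ssum_residues[OF p0, of "int p ^ a * M" E] by (simp add: mult.assoc)
    finally have "int p ^ Suc a dvd 2 * S" by (simp only:) (rule dvd_sum, rule part)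
    moreover have "coprime (int p ^ Suc a) 2"
    proof -
      have "odd p" using p False primes_dvd_imp_eq two_is_prime_nat by blast
      thus ?thesis by (simp add: coprime_right_2_iff_odd)
    qed
    ultimately show ?thesis using coprime_dvd_mult_right_iff by blast
  qed
  thus ?case using F unfolding red S_def[symmetric] by (simp add: mult_dvd_mono)
qed

section \<open>Windows with vertices\<close>

definition weight :: "int \<Rightarrow> int \<Rightarrow> int \<Rightarrow> int" where
  "weight l h x = (\<Prod>i\<in>{l..<h}. x + i)"

text \<open>The multiples of p among the factors sit at the vertices of the new window, and each of
  them yields one p.\<close>

lemma weight_restrict:
  fixes p :: nat and k l h :: int
  assumes "prime p"
  defines "l' \<equiv> (k + l - 1) div int p + 1" and "h' \<equiv> (k + h - 1) div int p + 1"
  shows "\<exists>u. \<forall>q. weight l h (int p * q + k) = int p ^ nat (h' - l') * weight l' h' q * poly u (int p * q)"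
proof -
  have p0: "int p > 0" using assms(1) by (simp add: prime_gt_0_nat)
  have "\<exists>u. \<forall>q. (\<Prod>i\<in>{l..<h}. int p * q + k + i)
          = int p ^ card {l'..<h'} * (\<Prod>i\<in>{l'..<h'}. q + i) * poly u (int p * q)"
  proof (rule prod_restrict_residue)
    fix i assume i: "i \<in> {l'..<h'}"
    have "k + l - 1 < int p * i"
    proof -
      have "(k + l - 1) div int p < i" using i by (simp add: l'_def)
      thus ?thesis using p0 by (simp add: int_div_less_iff)
    qed
    moreover have "int p * i \<le> k + h - 1"
    proof -
      have "i \<le> (k + h - 1) div int p" using i by (simp add: h'_def)
      thus ?thesis using int_div_less_iff[OF p0, of "k + h - 1" i] by simp
    qed
    ultimately show "int p * i - k \<in> {l..<h}" by simp
  qed (use p0 in auto)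
  thus ?thesis by (simp add: weight_def)
qed

text \<open>Descent over residue classes. The conditions l <= 1 <= h pass to the new window, so that
  a new window without vertices has l' = h' = 1.\<close>

lemma win_ssum_dvd:
  fixes p :: nat
  assumes p: "prime p"
  shows "F \<in> win l h \<Longrightarrow> l \<le> 1 \<Longrightarrow> 1 \<le> h \<Longrightarrow> l < h
     \<Longrightarrow> int p ^ a dvd ssum (int p ^ a * M) (\<lambda>q. F q * (weight l h q * poly u q))"
proof (induction a arbitrary: F u M l h)
  case 0
  show ?case by simp
next
  case (Suc a)
  have p0: "int p > 0" using p by (simp add: prime_gt_0_nat)
  have part: "int p ^ Suc a dvd ssum (int p ^ a * M)
      (\<lambda>q. F (int p * q + k) * (weight l h (int p * q + k) * poly u (int p * q + k)))"
    if k: "k \<in> {0..<int p}" for k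
  proof -
    define l' h' where "l' = (k + l - 1) div int p + 1" "h' = (k + h - 1) div int p + 1"
    obtain G where G: "G \<in> win l' h'" "restricts_to (int p) F k G"
      using win_restrict[OF p Suc.prems(1), of k] unfolding l'_h'_def by blast
    obtain v where v: "\<And>q. weight l h (int p * q + k)
                      = int p ^ nat (h' - l') * weight l' h' q * poly v (int p * q)"
      using weight_restrict[OF p, of l h k] unfolding l'_h'_def by blast
    have "(k + l - 1) div int p \<le> k div int p" using Suc.prems(2) p0 by (intro zdiv_mono1) auto
    hence l': "l' \<le> 1" using k by (simp add: l'_h'_def)
    have "0 \<le> (k + h - 1) div int p" using Suc.prems(3) k p0 by (simp add: pos_imp_zdiv_nonneg_iff)
    hence h': "1 \<le> h'" by (simp add: l'_h'_def)
    define u' where "u' = v * pcompose u [:k, 1:]"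
    have eq: "weight l h (int p * q + k) * poly u (int p * q + k)
              = int p ^ nat (h' - l') * weight l' h' q * poly u' (int p * q)" for q
      unfolding v u'_def by (simp add: poly_pcompose add.commute mult.assoc)
    show ?thesis
    proof (cases "l' < h'")
      case True
      \<comment> \<open>One of the factors p makes up for the lower exponent of the induction
        hypothesis; the other c are surplus.\<close>
      define c where "c = nat (h' - l') - 1"
      have c: "nat (h' - l') = Suc c" using True by (simp add: c_def)
      have "int p ^ a dvd ssum (int p ^ a * M)
              (\<lambda>q. F (int p * q + k) * (weight l' h' q * poly u' (int p * q)))"
      proof (rule restricts_to_dvd_ssum[OF G(2)])
        fix u
        \<comment> \<open>Composition with \<open>[:0, int p:]\<close> turns a polynomial in p q
          into one in q, as the induction hypothesis requires.\<close>
        have "int p ^ a dvd ssum (int p ^ a * M)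
            (\<lambda>q. G q * (weight l' h' q * poly (pcompose u [:0, int p:]) q))"
          by (rule Suc.IH[OF G(1) l' h' True])
        thus "int p ^ a dvd ssum (int p ^ a * M) (\<lambda>q. G q * (weight l' h' q * poly u (int p * q)))"
          by (simp add: poly_pcompose mult.commute)
      qed
      hence "int p ^ a * int p dvd int p ^ c * (ssum (int p ^ a * M)
              (\<lambda>q. F (int p * q + k) * (weight l' h' q * poly u' (int p * q))) * int p)"
        by (intro dvd_mult mult_dvd_mono) auto
      also have "\<dots> = ssum (int p ^ a * M)
          (\<lambda>q. F (int p * q + k) * (int p ^ nat (h' - l') * weight l' h' q * poly u' (int p * q)))"
        unfolding c power_Suc by (subst mult.commute, subst (2) mult.commute)
          (simp add: ssum_mult_left[symmetric] mult_ac)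
      finally show ?thesis unfolding eq by (simp add: mult.commute)
    next
      case False
      \<comment> \<open>Here the weight supplies no p, and the missing factor comes from the
        vertex-free case.\<close>
      hence lh: "l' = 1" "h' = 1" using l' h' by auto
      have "int p ^ Suc a dvd ssum (int p ^ a * M) (\<lambda>q. F (int p * q + k) * (1 * poly u' (int p * q)))"
        by (rule restricts_to_dvd_ssum[OF G(2)])
           (use win_1_1_ssum_dvd[OF p G(1)[unfolded lh]] in simp)
      thus ?thesis unfolding eq by (simp add: lh weight_def)
    qed
  qed
  have "ssum (int p ^ Suc a * M) (\<lambda>q. F q * (weight l h q * poly u q))
    = (\<Sum>k\<in>{0..<int p}. ssum (int p ^ a * M)
      (\<lambda>q. F (int p * q + k) * (weight l h (int p * q + k) * poly u (int p * q + k))))"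
    using ssum_residues[OF p0, of "int p ^ a * M" "\<lambda>q. F q * (weight l h q * poly u q)"]
    by (simp add: mult.assoc)
  thus ?case using part by (simp only:) (rule dvd_sum)
qed

subsection \<open>Assembling the coefficients\<close>

text \<open>Coefficients of products of polynomials are sums of products of window functions, and
  divisibility of signed sums passes to sums.\<close>

inductive_set win_span :: "int \<Rightarrow> int \<Rightarrow> (int \<Rightarrow> int) set" for l h :: int where
  zero: "(\<lambda>x. 0) \<in> win_span l h"
| add: "F \<in> win l h \<Longrightarrow> G \<in> win_span l h \<Longrightarrow> (\<lambda>x. F x + G x) \<in> win_span l h"

lemma win_imp_win_span: "F \<in> win l h \<Longrightarrow> F \<in> win_span l h"
  using win_span.add[OF _ win_span.zero] by simp

lemma win_span_add:
  assumes "F \<in> win_span l h" "G \<in> win_span l h"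
  shows "(\<lambda>x. F x + G x) \<in> win_span l h"
  using assms(1)
proof induction
  case (add F G')
  thus ?case using win_span.add[OF add.hyps(1) add.IH] by (simp add: add.assoc)
qed (simp add: assms(2))

lemma win_span_mult:
  assumes "F \<in> win_span l h" "G \<in> win_span l h"
  shows "(\<lambda>x. F x * G x) \<in> win_span l h"
proof -
  have *: "(\<lambda>x. F x * G x) \<in> win_span l h" if "F \<in> win l h" for F
    using assms(2)
  proof induction
    case (add G G')
    show ?case using win_span.add[OF win_mult[OF that add.hyps(1)] add.IH] by (simp add: distrib_left)
  qed (simp add: win_span.zero)
  show ?thesis using assms(1)
  proof induction
    case (add F F')
    show ?case using win_span_add[OF *[OF add.hyps(1)] add.IH] by (simp add: distrib_right)
  qed (simp add: win_span.zero)
qed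

lemma win_span_sum:
  assumes "\<And>i. i \<in> A \<Longrightarrow> F i \<in> win_span l h"
  shows "(\<lambda>x. \<Sum>i\<in>A. F i x) \<in> win_span l h"
  using assms by (induction A rule: infinite_finite_induct) (auto intro: win_span_add win_span.zero)

lemma win_span_power: "F \<in> win_span l h \<Longrightarrow> (\<lambda>x. F x ^ n) \<in> win_span l h"
  by (induction n) (auto intro: win_span_mult win_imp_win_span win.one)

lemma dvd_if_prime_powers_dvd:
  fixes x :: int
  assumes "d > 0" "\<And>p a. prime p \<Longrightarrow> p ^ a dvd d \<Longrightarrow> int p ^ a dvd x"
  shows "int d dvd x"
proof (cases "x = 0")
  case False
  have "d dvd nat \<bar>x\<bar>"
  proof (rule multiplicity_le_imp_dvd)
    fix p :: nat assume p: "prime p"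
    have "int (p ^ multiplicity p d) dvd x"
      using assms(2)[OF p multiplicity_dvd] by simp
    hence "p ^ multiplicity p d dvd nat \<bar>x\<bar>" by (simp only: dvd_nat_abs_iff)
    thus "multiplicity p d \<le> multiplicity p (nat \<bar>x\<bar>)"
      using p False by (intro multiplicity_geI) auto
  qed (use assms(1) in simp)
  thus ?thesis by (simp add: dvd_nat_abs_iff)
qed simp

lemma win_span_ssum_dvd:
  assumes F: "F \<in> win_span l h" and "l \<le> 1" "1 \<le> h" "l < h" "d > 0"
  shows "int d dvd ssum (int d) (\<lambda>q. F q * (weight l h q * poly u q))"
proof (rule dvd_if_prime_powers_dvd[OF assms(5)])
  fix p a assume p: "prime p" and "p ^ a dvd d"
  then obtain M where M: "d = p ^ a * M" by (elim dvdE)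
  show "int p ^ a dvd ssum (int d) (\<lambda>q. F q * (weight l h q * poly u q))"
    using F
  proof induction
    case zero
    show ?case by (simp add: ssum_def)
  next
    case (add F G)
    have "int p ^ a dvd ssum (int d) (\<lambda>q. F q * (weight l h q * poly u q))"
      using win_ssum_dvd[OF p add.hyps(1) assms(2-4), of a "int M" u] by (simp add: M)
    thus ?case using add.IH unfolding distrib_right ssum_add by simp
  qed
qed

section \<open>Polynomials with coefficients spanned by window functions\<close>

definition poly_win_span :: "int \<Rightarrow> int \<Rightarrow> (int \<Rightarrow> int poly) set" where
  "poly_win_span l h = {\<Phi>. \<forall>N. (\<lambda>x. coeff (\<Phi> x) N) \<in> win_span l h}"

lemma poly_win_span_mult:
  "\<Phi> \<in> poly_win_span l h \<Longrightarrow> \<Psi> \<in> poly_win_span l h \<Longrightarrow> (\<lambda>x. \<Phi> x * \<Psi> x) \<in> poly_win_span l h"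
  by (auto simp: poly_win_span_def coeff_mult intro!: win_span_sum win_span_mult)

lemma poly_win_span_one: "(\<lambda>x. 1) \<in> poly_win_span l h"
  unfolding poly_win_span_def
  by (auto simp: coeff_1 intro: win_span.zero win_imp_win_span win.one)

lemma poly_win_span_power: "\<Phi> \<in> poly_win_span l h \<Longrightarrow> (\<lambda>x. \<Phi> x ^ n) \<in> poly_win_span l h"
  by (induction n) (auto intro: poly_win_span_mult poly_win_span_one)

lemma poly_win_span_prod:
  "(\<And>i. i \<in> A \<Longrightarrow> \<Phi> i \<in> poly_win_span l h) \<Longrightarrow> (\<lambda>x. \<Prod>i\<in>A. \<Phi> i x) \<in> poly_win_span l h"
  by (induction A rule: infinite_finite_induct) (auto intro: poly_win_span_mult poly_win_span_one)

text \<open>Models \<open>w_poly\<close> with the index shifted by one and a cutoff J independent of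
  x, so that it makes sense for every integer x.\<close>

definition little_poly :: "nat \<Rightarrow> nat \<Rightarrow> int \<Rightarrow> int poly" where
  "little_poly \<alpha> J x = (\<Sum>j<J. monom (little j x ^ \<alpha>) j)"

lemma little_poly_reflect: "little_poly \<alpha> J (-1 - x) = little_poly \<alpha> J x"
  by (simp add: little_poly_def little_reflect)

lemma little_poly_in_span:
  assumes "l \<le> i" "i + 1 < h"
  shows "(\<lambda>x. little_poly \<alpha> J (x + i)) \<in> poly_win_span l h"
proof -
  have "(\<lambda>x. little j (x + i) * 1) \<in> win l h" for j
    using assms by (intro win.little win.one)
  hence "(\<lambda>x. little j (x + i) ^ \<alpha>) \<in> win_span l h" for j
    using win_span_power[OF win_imp_win_span] by simp
  hence "(\<lambda>x. if N < J then little N (x + i) ^ \<alpha> else 0) \<in> win_span l h" for N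
    by (cases "N < J") (auto intro: win_span.zero)
  thus ?thesis
    by (simp add: poly_win_span_def little_poly_def coeff_sum)
qed

section \<open>From signed sums to sums over positive arguments\<close>

text \<open>The set of 2b + 1 offsets is symmetric, so negating s permutes and negates an odd number
  of factors.\<close>

lemma weight_odd: "weight (- b) (b + 1) (- s) = - weight (- b) (b + 1) s" if "b \<ge> 0"
proof -
  have "weight (- b) (b + 1) (- s) = (\<Prod>i\<in>{- b..<b + 1}. (-1) * (s + i))"
    unfolding weight_def by (rule prod.reindex_bij_witness[of _ uminus uminus]) auto
  also have "\<dots> = (-1) ^ nat (2 * b + 1) * weight (- b) (b + 1) s"
    unfolding weight_def by (simp only: prod.distrib prod_constant) (simp add: algebra_simps)
  also have "odd (nat (2 * b + 1))" using that by (simp add: even_nat_iff)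
  hence "(-1) ^ nat (2 * b + 1) = (-1 :: int)" by simp
  finally show ?thesis by simp
qed

text \<open>At s = k + b this is (k + b) (k)_b (k + b + 1)_b, the factor of the theorem for r =
  1.\<close>

lemma weight_eq_pochhammer:
  "weight (- int b) (int b + 1) s = s * (pochhammer (s - int b) b * pochhammer (s + 1) b)"
proof -
  have "{- int b..<int b + 1} = insert 0 ({- int b..<0} \<union> {1..int b})" by auto
  hence "weight (- int b) (int b + 1) s = s * (\<Prod>i\<in>{- int b..<0} \<union> {1..int b}. s + i)"
    by (simp add: weight_def)
  also have "(\<Prod>i\<in>{- int b..<0} \<union> {1..int b}. s + i)
      = (\<Prod>i\<in>{- int b..<0}. s + i) * (\<Prod>i\<in>{1..int b}. s + i)"
    by (rule prod.union_disjoint) auto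
  also have "(\<Prod>i\<in>{- int b..<0}. s + i) = pochhammer (s - int b) b"
    unfolding pochhammer_prod
    by (rule prod.reindex_bij_witness[of _ "\<lambda>i. int i - int b" "\<lambda>i. nat (i + int b)"]) auto
  also have "(\<Prod>i\<in>{1..int b}. s + i) = pochhammer (s + 1) b"
    unfolding pochhammer_prod
    by (rule prod.reindex_bij_witness[of _ "\<lambda>i. int i + 1" "\<lambda>i. nat (i - 1)"]) auto
  finally show ?thesis .
qed

text \<open>The offset d - s lies in the window, so d is one of the factors. For d = 0 the weight
  vanishes.\<close>

lemma dvd_weight:
  assumes "\<bar>s - d\<bar> \<le> b"
  shows "d dvd weight (- b) (b + 1) s"
proof -
  have "s + (d - s) dvd weight (- b) (b + 1) s"
    unfolding weight_def using assms by (intro dvd_prodI) auto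
  thus ?thesis by simp
qed

text \<open>By oddness the signed sum is twice the sum over 1, ..., d minus F d. Passing from d to N
  adds or removes only arguments within distance b of d, where d divides the weight. The bound d - b
  - 1 <= N makes the first removed argument N + 1 at least d - b.\<close>

lemma odd_sum_dvd:
  fixes d b N :: int
  assumes F_odd: "\<And>s. F (- s) = - F s" and w: "\<And>s. weight (- b) (b + 1) s dvd F s"
    and T: "d dvd ssum d F" and d: "d > 0" and b: "b \<ge> 0"
    and N: "N \<ge> 0" "d - b - 1 \<le> N" "N \<le> d + b"
  shows "d dvd 2 * (\<Sum>s\<in>{1..N}. F s)"
proof -
  have F0: "F 0 = 0" using F_odd[of 0] by simp
  have near: "d dvd F s" if "\<bar>s - d\<bar> \<le> b" for s
    using dvd_trans[OF dvd_weight[OF that] w] .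
  have "ssum d F = (\<Sum>q\<in>{0..<d}. F q) + (\<Sum>q\<in>{0..<d}. F (q + 1))"
  proof -
    have "F (-1 - q) = - F (q + 1)" for q using F_odd[of "q + 1"] by (simp add: algebra_simps)
    thus ?thesis by (simp add: ssum_reflect sum.distrib)
  qed
  also have "(\<Sum>q\<in>{0..<d}. F (q + 1)) = (\<Sum>q\<in>{1..d}. F q)"
    by (rule sum.reindex_bij_witness[of _ "\<lambda>q. q - 1" "\<lambda>q. q + 1"]) auto
  also have "(\<Sum>q\<in>{0..<d}. F q) = (\<Sum>q\<in>{1..d}. F q) - F d"
  proof -
    have "{0..<d} = insert 0 {1..<d}" "{1..d} = insert d {1..<d}" using d by auto
    thus ?thesis using F0 by simp
  qed
  finally have "2 * (\<Sum>q\<in>{1..d}. F q) = ssum d F + F d" by simp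
  hence dd: "d dvd 2 * (\<Sum>q\<in>{1..d}. F q)" using T near[of d] b by simp
  show ?thesis
  proof (cases "N \<le> d")
    case True
    have "{1..d} = {1..N} \<union> {N+1..d}" using True N by auto
    hence "(\<Sum>q\<in>{1..d}. F q) = (\<Sum>q\<in>{1..N}. F q) + (\<Sum>q\<in>{N+1..d}. F q)"
      by (simp add: sum.union_disjoint)
    moreover have "d dvd (\<Sum>q\<in>{N+1..d}. F q)"
      using N by (intro dvd_sum near) auto
    ultimately show ?thesis using dd by (simp add: distrib_left dvd_add_left_iff)
  next
    case False
    have "{1..N} = {1..d} \<union> {d+1..N}" using False d by auto
    hence "(\<Sum>q\<in>{1..N}. F q) = (\<Sum>q\<in>{1..d}. F q) + (\<Sum>q\<in>{d+1..N}. F q)"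
      by (simp add: sum.union_disjoint)
    moreover have "d dvd (\<Sum>q\<in>{d+1..N}. F q)"
      using N by (intro dvd_sum near) auto
    ultimately show ?thesis using dd by (simp add: distrib_left)
  qed
qed

text \<open>The sum is centred by s = k + \<beta>. The bounds on d say exactly that the upper limit
  n + \<beta> of s lies between d - \<beta> - 1 and d + \<beta>.\<close>

lemma little_poly_sum_dvd:
  fixes \<alpha> \<beta> m n r J N d :: nat
  assumes "n \<le> d" "d \<le> n + 2 * \<beta> + 1" "d > 0" "r > 0"
  shows "int d dvd 2 * (\<Sum>k=1..n. pochhammer (int k) \<beta> ^ r * pochhammer (int (k + \<beta> + 1)) \<beta> ^ r * int (k + \<beta>)
           * coeff (\<Prod>i<2 * \<beta>. little_poly \<alpha> J (int (k + i)) ^ m) N)"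
proof -
  define \<Phi> where "\<Phi> s = (\<Prod>i<2 * \<beta>. little_poly \<alpha> J (s + (int i - int \<beta>)) ^ m)" for s
  define H where "H s = pochhammer (s - int \<beta>) \<beta> * pochhammer (s + 1) \<beta>" for s :: int
  \<comment> \<open>The factor s and one copy of H form the weight; the remaining r - 1 copies of H
    are this polynomial.\<close>
  define u where "u = (pochhammer [:- int \<beta>, 1:] \<beta> * pochhammer [:1, 1:] \<beta>) ^ (r - 1)"
  define F where "F s = coeff (\<Phi> s) N * (weight (- int \<beta>) (int \<beta> + 1) s * poly u s)" for s
  have weight_H: "weight (- int \<beta>) (int \<beta> + 1) s = s * H s" for s
    by (simp add: weight_eq_pochhammer H_def)
  have u: "poly u s = H s ^ (r - 1)" for s
    by (simp add: u_def H_def pochhammer_prod poly_prod algebra_simps)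
  \<comment> \<open>Negating s reverses the order of the product: the factor i becomes the reflected
    factor 2\<beta> - 1 - i.\<close>
  have \<Phi>_even: "\<Phi> (- s) = \<Phi> s" for s
    unfolding \<Phi>_def
  proof (rule prod.reindex_bij_witness[of _ "\<lambda>i. 2 * \<beta> - 1 - i" "\<lambda>i. 2 * \<beta> - 1 - i"])
    fix i assume "i \<in> {..<2 * \<beta>}"
    hence "- s + (int i - int \<beta>) = -1 - (s + (int (2 * \<beta> - 1 - i) - int \<beta>))" by (auto simp: of_nat_diff)
    thus "little_poly \<alpha> J (s + (int (2 * \<beta> - 1 - i) - int \<beta>)) ^ m = little_poly \<alpha> J (- s + (int i - int \<beta>)) ^ m"
      by (simp only: little_poly_reflect)
  qed auto
  have F_odd: "F (- s) = - F s" for s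
  proof (cases "s = 0")
    case True
    thus ?thesis by (simp add: F_def weight_H)
  next
    case False
    have "- s * H (- s) = - (s * H s)" using weight_odd[of "int \<beta>" s] by (simp add: weight_H)
    hence "H (- s) = H s" using False by simp
    thus ?thesis by (simp add: F_def \<Phi>_even weight_H u)
  qed
  have "(\<lambda>s. coeff (\<Phi> s) N) \<in> win_span (- int \<beta>) (int \<beta> + 1)"
  proof -
    \<comment> \<open>The offsets -\<beta>, ..., \<beta> - 1 are exactly the inner edges of the
      window -\<beta>, ..., \<beta>.\<close>
    have "\<Phi> \<in> poly_win_span (- int \<beta>) (int \<beta> + 1)"
      unfolding \<Phi>_def by (intro poly_win_span_prod poly_win_span_power little_poly_in_span) auto
    thus ?thesis by (simp add: poly_win_span_def)
  qed
  hence "int d dvd ssum (int d) F"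
    unfolding F_def by (rule win_span_ssum_dvd) (use assms in auto)
  hence "int d dvd 2 * (\<Sum>s\<in>{1..int (n + \<beta>)}. F s)"
    by (intro odd_sum_dvd[where b = "int \<beta>" and F = F] F_odd) (use assms in \<open>auto simp: F_def\<close>)
  \<comment> \<open>The arguments 1, ..., \<beta> contribute nothing, since the weight vanishes
    there.\<close>
  also have "(\<Sum>s\<in>{1..int (n + \<beta>)}. F s) = (\<Sum>s\<in>{int \<beta> + 1..int (n + \<beta>)}. F s)"
  proof (rule sum.mono_neutral_right)
    show "\<forall>s\<in>{1..int (n + \<beta>)} - {int \<beta> + 1..int (n + \<beta>)}. F s = 0"
    proof
      fix s assume "s \<in> {1..int (n + \<beta>)} - {int \<beta> + 1..int (n + \<beta>)}"
      hence "0 dvd weight (- int \<beta>) (int \<beta> + 1) s" by (intro dvd_weight) auto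
      thus "F s = 0" by (simp add: F_def)
    qed
  qed auto
  also have "\<dots> = (\<Sum>k=1..n. F (int (k + \<beta>)))"
    by (rule sum.reindex_bij_witness[of _ "\<lambda>k. int (k + \<beta>)" "\<lambda>s. nat (s - int \<beta>)"]) auto
  also have "\<dots> = (\<Sum>k=1..n. pochhammer (int k) \<beta> ^ r * pochhammer (int (k + \<beta> + 1)) \<beta> ^ r * int (k + \<beta>)
           * coeff (\<Prod>i<2 * \<beta>. little_poly \<alpha> J (int (k + i)) ^ m) N)"
  proof (rule sum.cong[OF refl])
    fix k
    have 1: "\<Phi> (int (k + \<beta>)) = (\<Prod>i<2 * \<beta>. little_poly \<alpha> J (int (k + i)) ^ m)"
      unfolding \<Phi>_def by simp
    have 2: "H (int (k + \<beta>)) = pochhammer (int k) \<beta> * pochhammer (int (k + \<beta> + 1)) \<beta>"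
      by (simp add: H_def add.commute)
    have "H (int (k + \<beta>)) * H (int (k + \<beta>)) ^ (r - 1) = H (int (k + \<beta>)) ^ r"
      using assms(4) by (simp flip: power_Suc)
    hence "F (int (k + \<beta>)) = coeff (\<Phi> (int (k + \<beta>))) N * (int (k + \<beta>) * H (int (k + \<beta>)) ^ r)"
      unfolding F_def weight_H u by (simp only: mult_ac)
    thus "F (int (k + \<beta>)) = pochhammer (int k) \<beta> ^ r * pochhammer (int (k + \<beta> + 1)) \<beta> ^ r * int (k + \<beta>)
           * coeff (\<Prod>i<2 * \<beta>. little_poly \<alpha> J (int (k + i)) ^ m) N"
      unfolding 1 2 power_mult_distrib by (simp only: mult_ac)
  qed
  finally show ?thesis .
qed

section \<open>Transfer to rational polynomials\<close>

abbreviation rat_poly :: "int poly \<Rightarrow> rat poly" where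
  "rat_poly \<equiv> map_poly of_int"

lemma coeff_rat_poly: "coeff (rat_poly p) i = of_int (coeff p i)"
  by (simp add: coeff_map_poly)

lemma rat_poly_add: "rat_poly (p + q) = rat_poly p + rat_poly q"
  by (rule poly_eqI) (simp add: coeff_rat_poly)

lemma rat_poly_mult: "rat_poly (p * q) = rat_poly p * rat_poly q"
  by (rule poly_eqI) (simp add: coeff_rat_poly coeff_mult)

lemma rat_poly_sum: "rat_poly (\<Sum>i\<in>A. f i) = (\<Sum>i\<in>A. rat_poly (f i))"
  by (induction A rule: infinite_finite_induct) (simp_all add: rat_poly_add)

lemma rat_poly_power: "rat_poly (p ^ n) = rat_poly p ^ n"
  by (induction n) (simp_all add: rat_poly_mult)

lemma rat_poly_prod: "rat_poly (\<Prod>i\<in>A. f i) = (\<Prod>i\<in>A. rat_poly (f i))"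
  by (induction A rule: infinite_finite_induct) (simp_all add: rat_poly_mult)

lemma rat_poly_monom: "rat_poly (monom c i) = monom (of_int c) i"
  by (rule poly_eqI) (simp add: coeff_rat_poly)

lemma int_polysI:
  assumes "\<And>i. coeff p i \<in> \<int>"
  shows "p \<in> int_polys"
proof -
  have "p = rat_poly (map_poly floor p)"
    by (rule poly_eqI) (use assms in \<open>simp add: coeff_map_poly\<close>)
  thus ?thesis unfolding int_polys_def by blast
qed

lemma little_int_Suc:
  "little j (int (Suc k)) = int (k choose j) * int ((Suc k + Suc j) choose Suc j)
     - int (Suc k choose Suc j) * int ((Suc k + Suc j) choose j)"
proof -
  have "int (Suc k) - 1 = int k" "int (Suc k) + int j + 1 = int (Suc k + Suc j)" by simp_all
  thus ?thesis by (simp only: little_def ichoose_int)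
qed

lemma w_num_eq_little:
  assumes "1 \<le> j" "j \<le> k"
  shows "w_num k j = of_int (little (j - 1) (int k))"
proof -
  obtain k' j' where "k = Suc k'" "j = Suc j'" using assms by (cases k; cases j) auto
  thus ?thesis using w_num_eq_diff[OF assms]
    by (simp only: little_int_Suc diff_Suc_1 of_int_diff of_int_mult of_int_of_nat_eq)
qed

text \<open>Both terms contain a binomial coefficient whose lower index exceeds the upper one. At k
  = 0 the value is 1 or -1 instead.\<close>

lemma little_eq_0:
  assumes "k \<ge> 1" "k \<le> j"
  shows "little j (int k) = 0"
proof -
  obtain k' where "k = Suc k'" using assms by (cases k) auto
  thus ?thesis using assms
    by (simp only: little_int_Suc) (simp add: binomial_eq_0 del: binomial_Suc_Suc)
qed

text \<open>The additional terms j >= k of \<open>little_poly\<close> vanish, which for the powers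
  requires \<alpha> > 0 because 0 ^ 0 = 1.\<close>

lemma w_poly_eq_little_poly:
  assumes "\<alpha> > 0" "k \<ge> 1" "k \<le> J"
  shows "w_poly \<alpha> k = rat_poly (little_poly \<alpha> J (int k))"
proof -
  have "rat_poly (little_poly \<alpha> J (int k)) = (\<Sum>j<J. monom (of_int (little j (int k)) ^ \<alpha>) j)"
    by (simp add: little_poly_def rat_poly_sum rat_poly_monom)
  also have "\<dots> = (\<Sum>j<k. monom (of_int (little j (int k)) ^ \<alpha>) j)"
    by (rule sum.mono_neutral_right) (use assms in \<open>auto simp: little_eq_0\<close>)
  also have "\<dots> = w_poly \<alpha> k"
    unfolding w_poly_def
    by (rule sum.reindex_bij_witness[of _ "\<lambda>j. j - 1" Suc]) (auto simp: w_num_eq_little)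
  finally show ?thesis ..
qed

theorem theorem6:
  fixes \<alpha> \<beta> m n r :: nat
  assumes "\<alpha> > 0" "\<beta> > 0" "m > 0" "n > 0" "r > 0"
  shows "smult (2 / of_nat (Lcm {n..n + 2 * \<beta> + 1}))
           (\<Sum>k=1..n. smult (pochhammer (of_nat k) \<beta> ^ r
                             * pochhammer (of_nat (k + \<beta> + 1)) \<beta> ^ r
                             * of_nat (k + \<beta>))
                       (\<Prod>i=0..2 * \<beta> - 1. w_poly \<alpha> (k + i) ^ m))
         \<in> int_polys"
proof (rule int_polysI)
  fix N
  \<comment> \<open>All indices k + i are at most n + 2\<beta> - 1, so one cutoff serves for every
    factor.\<close>
  define J where "J = n + 2 * \<beta>"
  define L where "L = Lcm {n..n + 2 * \<beta> + 1}"
  define c where "c k = pochhammer (int k) \<beta> ^ r * pochhammer (int (k + \<beta> + 1)) \<beta> ^ r * int (k + \<beta>)" for k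
  define P where "P k = (\<Prod>i<2 * \<beta>. little_poly \<alpha> J (int (k + i)) ^ m)" for k
  define S where "S = (\<Sum>k=1..n. c k * coeff (P k) N)"
  have of_int_pochhammer: "of_int (pochhammer x b) = (pochhammer (of_int x) b :: rat)" for x b
    by (simp add: pochhammer_prod)
  have c: "pochhammer (of_nat k) \<beta> ^ r * pochhammer (of_nat (k + \<beta> + 1)) \<beta> ^ r * of_nat (k + \<beta>)
           = (of_int (c k) :: rat)" for k
    by (simp add: c_def of_int_pochhammer)
  have P: "(\<Prod>i=0..2 * \<beta> - 1. w_poly \<alpha> (k + i) ^ m) = rat_poly (P k)" if "k \<in> {1..n}" for k
  proof -
    \<comment> \<open>For \<beta> = 0 the truncated subtraction would leave one index; positivity
      excludes this.\<close>
    have "{0..2 * \<beta> - 1} = {..<2 * \<beta>}" using assms(2) by auto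
    moreover have "w_poly \<alpha> (k + i) = rat_poly (little_poly \<alpha> J (int (k + i)))" if "i < 2 * \<beta>" for i
      using that \<open>k \<in> {1..n}\<close> assms(1) by (intro w_poly_eq_little_poly) (auto simp: J_def)
    ultimately show ?thesis by (simp add: P_def rat_poly_prod rat_poly_power)
  qed
  have "L dvd nat \<bar>2 * S\<bar>"
    unfolding L_def
  proof (rule Lcm_least)
    fix d assume "d \<in> {n..n + 2 * \<beta> + 1}"
    hence "int d dvd 2 * S"
      unfolding S_def c_def P_def using assms by (intro little_poly_sum_dvd) auto
    thus "d dvd nat \<bar>2 * S\<bar>" by (simp add: dvd_nat_abs_iff)
  qed
  hence "int L dvd 2 * S" by (simp add: dvd_nat_abs_iff)
  then obtain t where t: "2 * S = int L * t" by (elim dvdE)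
  \<comment> \<open>n > 0 keeps 0 out of the range, so the lcm is not 0.\<close>
  have "L \<noteq> 0" using assms(4) by (simp add: L_def Lcm_0_iff)
  have "coeff (smult (2 / of_nat L) (\<Sum>k=1..n. smult (of_int (c k)) (rat_poly (P k)))) N
        = 2 / of_nat L * of_int S"
    by (simp add: coeff_sum coeff_rat_poly S_def)
  also have "\<dots> = of_int (2 * S) / of_nat L" by simp
  also have "\<dots> = of_int t" unfolding t using \<open>L \<noteq> 0\<close> by simp
  finally have "coeff (smult (2 / of_nat L) (\<Sum>k=1..n. smult (of_int (c k)) (rat_poly (P k)))) N \<in> \<int>"
    by (simp only: Ints_of_int)
  also have "(\<Sum>k=1..n. smult (of_int (c k)) (rat_poly (P k)))
      = (\<Sum>k=1..n. smult (pochhammer (of_nat k) \<beta> ^ r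
                             * pochhammer (of_nat (k + \<beta> + 1)) \<beta> ^ r
                             * of_nat (k + \<beta>))
                       (\<Prod>i=0..2 * \<beta> - 1. w_poly \<alpha> (k + i) ^ m))"
    by (rule sum.cong[OF refl]) (simp only: c P)
  finally show "coeff (smult (2 / of_nat (Lcm {n..n + 2 * \<beta> + 1}))
           (\<Sum>k=1..n. smult (pochhammer (of_nat k) \<beta> ^ r
                             * pochhammer (of_nat (k + \<beta> + 1)) \<beta> ^ r
                             * of_nat (k + \<beta>))
                       (\<Prod>i=0..2 * \<beta> - 1. w_poly \<alpha> (k + i) ^ m))) N \<in> \<int>"
    unfolding L_def .
qed

end
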